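(* For every integer $n\ge 1$, with $a,b$ the two colors of $C_2$, $$\left|\Pi_n^{eq}\wr C_2(\{1^a2^a,1^b2^b\})\right|=2(2^n-1)=2^{n+1}-2.$$
   Context: $\Pi_n\wr C_2$ is the set of colored set partitions of $[n]$ with colors $a,b$ (a set partition of $[n]$ plus a color for each element). A colored partition eq-contains $1^\gamma2^\gamma$ if there are elements $x<y$ in different blocks both colored $\gamma$. $\Pi_n^{eq}\wr C_2(\{1^a2^a,1^b2^b\})$ is the set of colored partitions eq-containing neither $1^a2^a$ nor $1^b2^b$. *)

theory Defs
  imports Main "HOL-Library.Disjoint_Sets" "HOL-Library.FuncSet"
begin

datatype color = Col_a | Col_b

text \<open>A colored partition is a pair of a set partition and a coloring of its ground set; the
  coloring is extensional, so that each one is counted once.\<close>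

definition colored_partitions :: "nat \<Rightarrow> (nat set set \<times> (nat \<Rightarrow> color)) set" where
  "colored_partitions n =
     {(P, c). partition_on {1..n} P \<and> c \<in> {1..n} \<rightarrow>\<^sub>E (UNIV :: color set)}"

text \<open>Eq-containment of the pattern \<open>1\<^sup>g 2\<^sup>g\<close>.\<close>

definition eq_contains_12 :: "color \<Rightarrow> nat set set \<times> (nat \<Rightarrow> color) \<Rightarrow> bool" where
  "eq_contains_12 g = (\<lambda>(P, c). \<exists>B\<in>P. \<exists>D\<in>P. B \<noteq> D \<and>
     (\<exists>x\<in>B. \<exists>y\<in>D. x < y \<and> c x = g \<and> c y = g))"

text \<open>The set \<open>G\<close> stands for the set of patterns \<open>1\<^sup>g 2\<^sup>g\<close> with \<open>g \<in> G\<close>.\<close>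

definition eq_avoiders_12 :: "nat \<Rightarrow> color set \<Rightarrow> (nat set set \<times> (nat \<Rightarrow> color)) set" where
  "eq_avoiders_12 n G = {\<pi> \<in> colored_partitions n. \<forall>g\<in>G. \<not> eq_contains_12 g \<pi>}"

end

theory Submission
  imports Defs
begin

text \<open>A colored partition avoids both patterns iff equally colored elements always share a block.
  So there is either a single block with any of the \<open>2 ^ n\<close> colorings, or the blocks are exactly the
  two color classes of one of the \<open>2 ^ n - 2\<close> non-constant colorings.\<close>

lemma UNIV_color: "(UNIV :: color set) = {Col_a, Col_b}"
  using color.exhaust by auto

text \<open>Elements of distinct blocks are distinct because the blocks are disjoint, and both carry
  the same color, so exchanging the two blocks turns \<open>y < x\<close> into \<open>x < y\<close>.
  The order condition can therefore be dropped.\<close>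

lemma eq_contains_12_iff:
  assumes "partition_on A P"
  shows "eq_contains_12 g (P, c) \<longleftrightarrow>
    (\<exists>B\<in>P. \<exists>D\<in>P. B \<noteq> D \<and> (\<exists>x\<in>B. \<exists>y\<in>D. c x = g \<and> c y = g))"
proof -
  have less: "x < y \<or> y < x" if "B \<in> P" "D \<in> P" "B \<noteq> D" "x \<in> B" "y \<in> D" for B D x y
  proof -
    have "B \<inter> D = {}" using partition_onD2[OF assms] that(1-3) by (rule disjointD)
    then have "x \<noteq> y" using that by blast
    then show ?thesis by linarith
  qed
  show ?thesis
    unfolding eq_contains_12_def prod.case
  proof (intro iffI; elim bexE conjE)
    fix B D x y
    assume *: "B \<in> P" "D \<in> P" "B \<noteq> D" "x \<in> B" "y \<in> D" "c x = g" "c y = g"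
    show "\<exists>B\<in>P. \<exists>D\<in>P. B \<noteq> D \<and> (\<exists>x\<in>B. \<exists>y\<in>D. x < y \<and> c x = g \<and> c y = g)"
      using less[OF *(1-5)] * by blast
  qed blast
qed

text \<open>For a coloring that misses a color, this family contains the empty set and so is not a
  set partition.\<close>

definition color_classes :: "nat set \<Rightarrow> (nat \<Rightarrow> color) \<Rightarrow> nat set set" where
  "color_classes A c = {{x \<in> A. c x = Col_a}, {x \<in> A. c x = Col_b}}"

text \<open>The restriction to \<open>A\<close> makes these functions extensional, hence members of
  the space of colorings being counted.\<close>

definition constant_colorings :: "nat set \<Rightarrow> (nat \<Rightarrow> color) set" where
  "constant_colorings A = (\<lambda>g. \<lambda>x\<in>A. g) ` UNIV"

text \<open>Allows the classes to be named after the colors of chosen representatives, in either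
  order.\<close>

lemma color_classes_eq:
  assumes "g \<noteq> h"
  shows "color_classes A c = {{x \<in> A. c x = g}, {x \<in> A. c x = h}}"
  using assms unfolding color_classes_def by (cases g; cases h) auto

text \<open>With only two colors, not being constantly one of them means taking the other.
  Extensionality turns constancy on \<open>A\<close> into equality with a restricted constant
  function.\<close>

lemma nonconstant_coloring_iff:
  assumes "c \<in> A \<rightarrow>\<^sub>E (UNIV :: color set)"
  shows "c \<notin> constant_colorings A \<longleftrightarrow> (\<forall>g. \<exists>x\<in>A. c x = g)"
proof -
  have *: "c = (\<lambda>x\<in>A. g) \<longleftrightarrow> (\<forall>x\<in>A. c x = g)" for g
    using assms by (auto simp: PiE_def extensional_def fun_eq_iff)
  have all: "(\<forall>g. Q g) \<longleftrightarrow> Q Col_a \<and> Q Col_b" for Q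
    using color.exhaust by metis
  have neg: "c x \<noteq> Col_a \<longleftrightarrow> c x = Col_b" "c x \<noteq> Col_b \<longleftrightarrow> c x = Col_a" for x
    by (cases "c x"; simp)+
  have other: "(\<forall>g. \<not> (\<forall>x\<in>A. c x = g)) \<longleftrightarrow> (\<forall>g. \<exists>x\<in>A. c x = g)"
    unfolding all by (auto simp: neg)
  show ?thesis
    unfolding constant_colorings_def image_iff using * other by auto
qed

lemma partition_on_color_classes:
  assumes "\<And>g. \<exists>x\<in>A. c x = g"
  shows "partition_on A (color_classes A c)"
proof (rule partition_onI)
  show "\<Union> (color_classes A c) = A"
    unfolding color_classes_def using color.exhaust by auto
  show "{} \<notin> color_classes A c"
    using assms unfolding color_classes_def by auto
qed (auto simp: color_classes_def disjnt_def)

lemma avoids_12_iff: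
  assumes P: "partition_on A P" and A: "A \<noteq> {}"
  shows "(\<forall>g. \<not> eq_contains_12 g (P, c)) \<longleftrightarrow>
    P = {A} \<or> (P = color_classes A c \<and> (\<forall>g. \<exists>x\<in>A. c x = g))"
    (is "?L \<longleftrightarrow> ?R")
proof
  assume ?L
  then have same: "B = D" if "B \<in> P" "D \<in> P" "x \<in> B" "y \<in> D" "c x = c y" for B D x y
    using that unfolding eq_contains_12_iff[OF P] by blast
  have un: "\<Union>P = A" and ne: "{} \<notin> P"
    using P by (auto simp: partition_on_def)
  show ?R
  proof (cases "P = {A}")
    case False
    have "P \<noteq> {}" using un A by auto
    then obtain B where B: "B \<in> P" by auto
    with False un have "P \<noteq> {B}" by auto
    with B obtain D where D: "D \<in> P" "D \<noteq> B" by auto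
    obtain x y where xy: "x \<in> B" "y \<in> D" using B D ne by (cases "B = {}"; cases "D = {}") auto
    \<comment> \<open>Equal colors would put \<open>x\<close> and \<open>y\<close> in one block, so
      these two colors are all there are.\<close>
    have neq: "c x \<noteq> c y" using same B D xy by blast
    have two: "c z = c x \<or> c z = c y" for z
      using neq by (cases "c z"; cases "c x"; cases "c y") auto
    \<comment> \<open>Each element shares its color with \<open>x\<close> or \<open>y\<close>, and
      avoidance then forces its block to be \<open>B\<close> or \<open>D\<close>; a third block is
      impossible.\<close>
    have block: "E = B \<and> c z = c x \<or> E = D \<and> c z = c y" if "E \<in> P" "z \<in> E" for E z
      using two[of z] same[OF that(1) B that(2) xy(1)] same[OF that(1) D(1) that(2) xy(2)] by blast
    have "B = {z \<in> A. c z = c x}"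
    proof (rule set_eqI)
      fix z
      show "z \<in> B \<longleftrightarrow> z \<in> {z \<in> A. c z = c x}"
        using block[of _ z] B D un neq by auto
    qed
    moreover have "D = {z \<in> A. c z = c y}"
    proof (rule set_eqI)
      fix z
      show "z \<in> D \<longleftrightarrow> z \<in> {z \<in> A. c z = c y}"
        using block[of _ z] B D un neq by auto
    qed
    moreover have "P = {B, D}"
    proof
      show "P \<subseteq> {B, D}"
      proof
        fix E assume E: "E \<in> P"
        with ne obtain z where "z \<in> E" by (cases "E = {}") auto
        with block[OF E] show "E \<in> {B, D}" by blast
      qed
    qed (use B D in blast)
    ultimately have "P = color_classes A c"
      using color_classes_eq[OF neq] by simp
    moreover have "\<exists>x\<in>A. c x = g" for g
    proof -
      have "g = c x \<or> g = c y" using neq by (cases g; cases "c x"; cases "c y") auto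
      then show ?thesis using B D xy un by blast
    qed
    ultimately show ?thesis by blast
  qed simp
next
  assume ?R
  then show ?L
    unfolding eq_contains_12_iff[OF P] by (auto simp: color_classes_def)
qed

text \<open>Writing the avoiders as images of sets of colorings reduces the count to counting
  colorings.\<close>

lemma eq_avoiders_12_both:
  assumes "n \<ge> 1"
  shows "eq_avoiders_12 n {Col_a, Col_b} =
    (\<lambda>c. ({{1..n}}, c)) ` ({1..n} \<rightarrow>\<^sub>E UNIV) \<union>
    (\<lambda>c. (color_classes {1..n} c, c)) ` (({1..n} \<rightarrow>\<^sub>E UNIV) - constant_colorings {1..n})"
    (is "?L = ?S \<union> ?T")
proof -
  let ?A = "{1..n}"
  have A: "?A \<noteq> {}" using assms by simp
  have "(P, c) \<in> ?L \<longleftrightarrow> (P, c) \<in> ?S \<union> ?T" for P c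
  proof -
    have "(P, c) \<in> ?L \<longleftrightarrow> partition_on ?A P \<and> c \<in> ?A \<rightarrow>\<^sub>E UNIV \<and> (\<forall>g. \<not> eq_contains_12 g (P, c))"
      unfolding eq_avoiders_12_def colored_partitions_def UNIV_color[symmetric] by simp
    also have "\<dots> \<longleftrightarrow> c \<in> ?A \<rightarrow>\<^sub>E UNIV \<and>
        (P = {?A} \<or> (P = color_classes ?A c \<and> (\<forall>g. \<exists>x\<in>?A. c x = g)))"
      using avoids_12_iff[OF _ A] partition_on_color_classes partition_on_space[OF A] by blast
    also have "\<dots> \<longleftrightarrow> (P, c) \<in> ?S \<union> ?T"
      using nonconstant_coloring_iff[of c ?A] by blast
    finally show ?thesis .
  qed
  then show ?thesis by (simp add: set_eq_iff)
qed

text \<open>Evaluation at a point of \<open>A\<close> recovers the color; on the empty set the two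
  constant colorings would coincide.\<close>

lemma card_constant_colorings:
  assumes "A \<noteq> {}"
  shows "card (constant_colorings A) = 2"
proof -
  obtain x where "x \<in> A" using assms by auto
  then have "inj (\<lambda>g::color. \<lambda>x\<in>A. g)"
    by (intro injI) (metis restrict_apply')
  then have "card (constant_colorings A) = card (UNIV :: color set)"
    unfolding constant_colorings_def by (rule card_image)
  then show ?thesis by (simp add: UNIV_color)
qed

theorem theorem3p3:
  fixes n :: nat
  assumes "n \<ge> 1"
  shows "int (card (eq_avoiders_12 n {Col_a, Col_b})) = 2 * (2 ^ n - 1)
    \<and> (2 * (2 ^ n - 1) :: int) = 2 ^ (n + 1) - 2"
proof -
  let ?A = "{1..n}"
  let ?C = "?A \<rightarrow>\<^sub>E (UNIV :: color set)"
  let ?K = "constant_colorings ?A"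
  let ?S = "(\<lambda>c. ({?A}, c)) ` ?C"
  let ?T = "(\<lambda>c. (color_classes ?A c, c)) ` (?C - ?K)"
  have cardC: "card ?C = 2 ^ n"
    by (simp add: card_PiE UNIV_color numeral_2_eq_2)
  have finC: "finite ?C"
    by (intro finite_PiE) (simp_all add: UNIV_color)
  have K: "?K \<subseteq> ?C" by (auto simp: constant_colorings_def)
  have cardK: "card ?K = 2" using assms by (intro card_constant_colorings) simp
  \<comment> \<open>Ensures that the truncated subtraction \<open>2 ^ n - 2\<close> on naturals
    agrees with the one on integers.\<close>
  have le: "2 \<le> card ?C" using card_mono[OF finC K] cardK by simp
  have cardD: "card (?C - ?K) = 2 ^ n - 2"
    using card_Diff_subset[OF finite_subset[OF K finC] K] cardC cardK by simp
  \<comment> \<open>Both maps are injective because the coloring is kept as second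
    component.\<close>
  have cardS: "card ?S = card ?C" by (intro card_image inj_onI) simp
  have cardT: "card ?T = card (?C - ?K)" by (intro card_image inj_onI) simp
  \<comment> \<open>Otherwise both color classes would equal the nonempty ground set, giving some
    element two colors.\<close>
  have "color_classes ?A c \<noteq> {?A}" for c
  proof
    assume "color_classes ?A c = {?A}"
    then have "{x \<in> ?A. c x = Col_a} = ?A" "{x \<in> ?A. c x = Col_b} = ?A"
      unfolding color_classes_def by blast+
    moreover obtain x where "x \<in> ?A" using assms by auto
    ultimately have "c x = Col_a" "c x = Col_b" by blast+
    then show False by simp
  qed
  then have disj: "?S \<inter> ?T = {}"
    by (simp add: disjoint_iff image_iff) metis
  have "card (eq_avoiders_12 n {Col_a, Col_b}) = card ?S + card ?T"
    unfolding eq_avoiders_12_both[OF assms] using finC disj by (intro card_Un_disjoint) simp_all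
  moreover have "int (2 ^ n - 2) = 2 ^ n - 2"
    using le cardC by simp
  ultimately show ?thesis unfolding cardS cardT cardC cardD by simp
qed

end
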